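(* Let $W\ge 0$ be a random variable with mean $\mu$ and variance $\sigma^2\in(0,\infty)$. Let $W^s$ have the $W$-size biased distribution and let $W^z$ have the $W$-zero biased distribution. Then $W\sim\Gamma(r,\alpha)$ for some $r,\alpha>0$ if and only if $W^s\stackrel{d}{=}W^z$.
   Context: $\stackrel{d}{=}$ denotes equality in distribution. $\Gamma(r,\alpha)$ ($r,\alpha>0$) is the distribution with density $\frac{1}{\Gamma(r)}\alpha^r x^{r-1}e^{-\alpha x}$, $x>0$. Size bias: for a nonnegative random variable $V$ with finite mean $\mu>0$, $V^s$ has the $V$-size biased distribution if $\mathbb{E}[Vf(V)]=\mu\,\mathbb{E}f(V^s)$ for all functions $f$ with $\mathbb{E}|Vf(V)|<\infty$. Zero bias: for a random variable $W$ with mean $\mu$ and variance $\sigma^2\in(0,\infty)$, $W^z$ has the $W$-zero biased distribution if $\mathbb{E}[(W-\mu)f(W)]=\sigma^2\,\mathbb{E}f'(W^z)$ for all differentiable functions $f$ with $\mathbb{E}|Wf(W)|<\infty$ and for which $\mathbb{E}|f'(W^z)|<\infty$. *)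

theory Defs
  imports "HOL-Probability.Probability"
begin

(* Shape r, rate alpha. *)
definition gamma_density :: "real \<Rightarrow> real \<Rightarrow> real \<Rightarrow> real" where
  "gamma_density r \<alpha> x =
     (if x > 0 then 1 / Gamma r * \<alpha> powr r * x powr (r - 1) * exp (- \<alpha> * x) else 0)"

(* The random variable V lives on M and Vs on a possibly different space N.  The test functions
   range over all Borel functions with E|V f(V)| finite.  Since integral of a non-integrable
   function is 0 in HOL-Analysis, the existence of E f(Vs) is stated explicitly. *)
definition size_biased ::
  "'a measure \<Rightarrow> ('a \<Rightarrow> real) \<Rightarrow> 'b measure \<Rightarrow> ('b \<Rightarrow> real) \<Rightarrow> bool" where
  "size_biased M V N Vs \<longleftrightarrow>
     prob_space M \<and> V \<in> borel_measurable M \<and> (AE x in M. 0 \<le> V x) \<and>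
     integrable M V \<and> 0 < (\<integral>x. V x \<partial>M) \<and>
     prob_space N \<and> Vs \<in> borel_measurable N \<and>
     (\<forall>f :: real \<Rightarrow> real. f \<in> borel_measurable borel \<longrightarrow> integrable M (\<lambda>x. V x * f (V x)) \<longrightarrow>
        integrable N (\<lambda>y. f (Vs y)) \<and>
        (\<integral>x. V x * f (V x) \<partial>M) = (\<integral>x. V x \<partial>M) * (\<integral>y. f (Vs y) \<partial>N))"

(* The test functions are differentiable on the whole real line, with derivative f'.  The left-hand
   expectation exists: f(W) is integrable because f is bounded near 0 and W f(W) is integrable. *)
definition zero_biased ::
  "'a measure \<Rightarrow> ('a \<Rightarrow> real) \<Rightarrow> 'b measure \<Rightarrow> ('b \<Rightarrow> real) \<Rightarrow> bool" where
  "zero_biased M W N Wz \<longleftrightarrow>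
     prob_space M \<and> W \<in> borel_measurable M \<and> integrable M W \<and>
     integrable M (\<lambda>x. (W x)\<^sup>2) \<and> 0 < prob_space.variance M W \<and>
     prob_space N \<and> Wz \<in> borel_measurable N \<and>
     (\<forall>f f' :: real \<Rightarrow> real. (\<forall>t. (f has_real_derivative f' t) (at t)) \<longrightarrow>
        integrable M (\<lambda>x. W x * f (W x)) \<longrightarrow> integrable N (\<lambda>y. f' (Wz y)) \<longrightarrow>
        (\<integral>x. (W x - (\<integral>x. W x \<partial>M)) * f (W x) \<partial>M) =
          prob_space.variance M W * (\<integral>y. f' (Wz y) \<partial>N))"

end

theory Submission
  imports Defs "HOL-Real_Asymp.Real_Asymp"
begin

text \<open>Testing the biased distributions against \<open>cos (t w)\<close> and \<open>sin (t w)\<close> gives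
  \<open>\<mu> E exp(i t W\<^sup>s) = E[W exp(i t W)]\<close> and
  \<open>i t \<sigma>\<^sup>2 E exp(i t W\<^sup>z) = E[(W - \<mu>) exp(i t W)]\<close>. Hence \<open>W\<^sup>s\<close> and \<open>W\<^sup>z\<close> have
  the same characteristic function iff \<open>E[(\<alpha> W - r) exp(i t W)] = i t E[W exp(i t W)]\<close> for all \<open>t\<close>,
  with \<open>\<alpha> = \<mu> / \<sigma>\<^sup>2\<close> and \<open>r = \<mu>\<^sup>2 / \<sigma>\<^sup>2\<close>. This is the Stein identity of \<open>\<Gamma>(r, \<alpha>)\<close>, tested
  on exponentials; it holds for \<open>\<Gamma>(r, \<alpha>)\<close> by integration by parts, and it determines the law because
  it is a first-order linear differential equation for the characteristic function of \<open>W\<close>.\<close>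

section \<open>Differentiating a characteristic function\<close>

text \<open>In this form the derivative can be tested along sequences, as dominated convergence
  requires.\<close>

lemma has_vector_derivative_iff_quotient:
  "(f has_vector_derivative D) (at t) \<longleftrightarrow> ((\<lambda>s. (f s - f t) /\<^sub>R (s - t)) \<longlongrightarrow> D) (at t)"
proof -
  have "((\<lambda>s. norm (f s - f t - (s - t) *\<^sub>R D) / norm (s - t)) \<longlongrightarrow> 0) (at t) \<longleftrightarrow>
      ((\<lambda>s. norm ((f s - f t) /\<^sub>R (s - t) - D)) \<longlongrightarrow> 0) (at t)"
  proof (rule LIM_cong)
    fix s :: real assume "s \<noteq> t"
    then have "f s - f t - (s - t) *\<^sub>R D = (s - t) *\<^sub>R ((f s - f t) /\<^sub>R (s - t) - D)"
      by (simp add: scaleR_diff_right)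
    then show "norm (f s - f t - (s - t) *\<^sub>R D) / norm (s - t) = norm ((f s - f t) /\<^sub>R (s - t) - D)"
      using \<open>s \<noteq> t\<close> by simp
  qed auto
  then show ?thesis
    unfolding has_vector_derivative_def has_derivative_iff_norm
    by (simp add: bounded_linear_scaleR_left tendsto_norm_zero_iff LIM_zero_iff)
qed

text \<open>Differentiation under the integral sign: the difference quotients of
  \<open>iexp (t * x)\<close> in \<open>t\<close> are bounded by \<open>\<bar>x\<bar>\<close>, which
  is integrable.\<close>

lemma (in real_distribution) char_has_vector_derivative:
  assumes int: "integrable M (\<lambda>x. x)"
  shows "(char M has_vector_derivative \<i> * (\<integral>x. of_real x * iexp (t * x) \<partial>M)) (at t)"
proof -
  let ?D = "\<lambda>x. \<i> * of_real x * iexp (t * x)"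
  have "((\<lambda>s. (char M s - char M t) /\<^sub>R (s - t)) \<longlongrightarrow> (\<integral>x. ?D x \<partial>M)) (at t)"
    unfolding tendsto_at_iff_sequentially comp_def
  proof (intro allI impI)
    fix X :: "nat \<Rightarrow> real"
    assume X: "\<forall>i. X i \<in> UNIV - {t}" and lim: "X \<longlonglongrightarrow> t"
    have iexp_int: "integrable M (\<lambda>x. iexp (s * x))" for s
      by (intro integrable_iexp) auto
    have eq: "(char M (X n) - char M t) /\<^sub>R (X n - t) =
        (\<integral>x. (iexp (X n * x) - iexp (t * x)) /\<^sub>R (X n - t) \<partial>M)" for n
      unfolding char_def by (subst Bochner_Integration.integral_diff[symmetric, OF iexp_int iexp_int]) simp
    show "(\<lambda>n. (char M (X n) - char M t) /\<^sub>R (X n - t)) \<longlonglongrightarrow> (\<integral>x. ?D x \<partial>M)"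
      unfolding eq
    proof (rule integral_dominated_convergence[where w = "\<lambda>x. \<bar>x\<bar>"])
      show "integrable M (\<lambda>x. \<bar>x\<bar>)"
        using int by simp
      show "AE x in M. (\<lambda>n. (iexp (X n * x) - iexp (t * x)) /\<^sub>R (X n - t)) \<longlonglongrightarrow> ?D x"
      proof (rule AE_I2)
        fix x
        have "((\<lambda>s. iexp (s * x)) has_vector_derivative ?D x) (at t)"
          by (auto intro!: derivative_eq_intros simp: has_vector_derivative_complex_iff Re_exp Im_exp)
        then have "((\<lambda>s. (iexp (s * x) - iexp (t * x)) /\<^sub>R (s - t)) \<longlongrightarrow> ?D x) (at t)"
          by (simp only: has_vector_derivative_iff_quotient)
        then show "(\<lambda>n. (iexp (X n * x) - iexp (t * x)) /\<^sub>R (X n - t)) \<longlonglongrightarrow> ?D x"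
          using X lim by (simp add: tendsto_at_iff_sequentially comp_def)
      qed
      show "AE x in M. norm ((iexp (X n * x) - iexp (t * x)) /\<^sub>R (X n - t)) \<le> \<bar>x\<bar>" for n
      proof (rule AE_I2)
        fix x
        \<comment> \<open>Splitting off a factor of modulus 1 leaves \<open>iexp u - 1\<close> with
          \<open>u = (X n - t) * x\<close>, whose modulus is at most
          \<open>\<bar>u\<bar>\<close>.\<close>
        have "iexp (X n * x) - iexp (t * x) = iexp (t * x) * (iexp ((X n - t) * x) - 1)"
          by (simp add: algebra_simps flip: exp_add)
        moreover have "cmod (iexp ((X n - t) * x) - 1) \<le> \<bar>(X n - t) * x\<bar>"
          using iexp_approx1[of "(X n - t) * x" 0] by simp
        ultimately have "cmod (iexp (X n * x) - iexp (t * x)) \<le> \<bar>X n - t\<bar> * \<bar>x\<bar>"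
          by (simp add: norm_mult abs_mult)
        moreover have "\<bar>X n - t\<bar> > 0"
          using X by simp
        ultimately show "norm ((iexp (X n * x) - iexp (t * x)) /\<^sub>R (X n - t)) \<le> \<bar>x\<bar>"
          by (simp add: divide_simps mult.commute)
      qed
    qed auto
  qed
  then show ?thesis
    by (simp add: has_vector_derivative_iff_quotient mult.assoc)
qed

section \<open>The Stein identity and the law it determines\<close>

text \<open>With \<open>f x = iexp (t * x)\<close> this is
  \<open>E[(\<alpha> X - r) f(X)] = E[X f'(X)]\<close>. Integrals that do not exist count as 0, so
  it is applied only to laws with a finite first moment.\<close>

definition gamma_stein :: "real \<Rightarrow> real \<Rightarrow> real measure \<Rightarrow> bool" where
  "gamma_stein r \<alpha> M \<longleftrightarrow> (\<forall>t.
     (\<integral>x. of_real (\<alpha> * x - r) * iexp (t * x) \<partial>M) = \<i> * of_real t * (\<integral>x. of_real x * iexp (t * x) \<partial>M))"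

lemma (in real_distribution) integrable_times_iexp:
  assumes "integrable M (\<lambda>x. x)"
  shows "integrable M (\<lambda>x. of_real x * iexp (t * x))"
proof (rule Bochner_Integration.integrable_bound[OF integrable_norm[OF assms]])
qed (auto simp: norm_mult)

text \<open>The integral that remains is \<open>- \<i>\<close> times the derivative of
  \<open>char M\<close>, so this form is a linear differential equation for
  \<open>char M\<close>.\<close>

lemma (in real_distribution) gamma_stein_iff_char:
  assumes "integrable M (\<lambda>x. x)"
  shows "gamma_stein r \<alpha> M \<longleftrightarrow> (\<forall>t.
    (of_real \<alpha> - \<i> * of_real t) * (\<integral>x. of_real x * iexp (t * x) \<partial>M) = of_real r * char M t)"
proof -
  have "(\<integral>x. of_real (\<alpha> * x - r) * iexp (t * x) \<partial>M) =
      of_real \<alpha> * (\<integral>x. of_real x * iexp (t * x) \<partial>M) - of_real r * char M t" for t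
  proof -
    have "(\<integral>x. of_real (\<alpha> * x - r) * iexp (t * x) \<partial>M) =
        (\<integral>x. of_real \<alpha> * (of_real x * iexp (t * x)) - of_real r * iexp (t * x) \<partial>M)"
      by (simp add: algebra_simps)
    also have "\<dots> = of_real \<alpha> * (\<integral>x. of_real x * iexp (t * x) \<partial>M) - of_real r * char M t"
      unfolding char_def
      by (subst Bochner_Integration.integral_diff)
        (use integrable_times_iexp[OF assms, of t] in \<open>auto intro!: integrable_iexp\<close>)
    finally show ?thesis .
  qed
  then show ?thesis
    unfolding gamma_stein_def by (intro all_cong1) (simp only:, auto simp: algebra_simps)
qed

text \<open>This is the solution of the differential equation with value 1 at 0, namely the
  principal power \<open>(\<alpha> / (\<alpha> - \<i> t)) powr r\<close>.\<close>

lemma (in real_distribution) gamma_stein_char: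
  assumes int: "integrable M (\<lambda>x. x)" and stein: "gamma_stein r \<alpha> M" and "0 < \<alpha>"
  shows "char M t = exp (of_real r * (Ln (of_real \<alpha>) - Ln (of_real \<alpha> - \<i> * of_real t)))"
proof -
  \<comment> \<open>An integrating factor: \<open>(\<alpha> - i t) \<phi>'(t) = i r \<phi>(t)\<close> for \<open>\<phi> = char M\<close>.\<close>
  define E where "E s = exp (of_real r * Ln (of_real \<alpha> - \<i> * of_real s))" for s
  have "((\<lambda>s. char M s * E s) has_vector_derivative 0) (at s)" for s
  proof -
    let ?z = "of_real \<alpha> - \<i> * of_real s" and ?D = "\<integral>x. of_real x * iexp (s * x) \<partial>M"
    \<comment> \<open>The positive real part keeps \<open>?z\<close> off the branch cut of
      \<open>Ln\<close>.\<close>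
    have re: "Re ?z > 0"
      using \<open>0 < \<alpha>\<close> by simp
    then have z: "?z \<notin> \<real>\<^sub>\<le>\<^sub>0"
      by (auto simp: complex_nonpos_Reals_iff)
    have z0: "?z \<noteq> 0"
      using re by force
    \<comment> \<open>The derivative is taken in a complex variable first; restricting it to the
      real line differentiates \<open>E\<close>.\<close>
    have "((\<lambda>w. exp (of_real r * Ln (of_real \<alpha> - \<i> * w))) has_field_derivative
        E s * (of_real r * (- \<i> / ?z))) (at (of_real s))"
      using z z0 by (auto intro!: derivative_eq_intros simp: E_def field_simps)
    then have "(E has_vector_derivative E s * (of_real r * (- \<i> / ?z))) (at s)"
      using has_vector_derivative_real_field unfolding E_def by fastforce
    from has_vector_derivative_mult[OF char_has_vector_derivative[OF int] this]
    have "((\<lambda>s. char M s * E s) has_vector_derivative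
        char M s * (E s * (of_real r * (- \<i> / ?z))) + \<i> * ?D * E s) (at s)" .
    moreover have "?z * ?D = of_real r * char M s"
      using stein gamma_stein_iff_char[OF int] by simp
    then have "?D = of_real r * char M s / ?z"
      using z0 by (simp add: field_simps)
    ultimately show ?thesis
      by (simp add: algebra_simps)
  qed
  then obtain c where c: "\<And>s. char M s * E s = c"
    using has_vector_derivative_zero_constant[of UNIV "\<lambda>s. char M s * E s"] by auto
  have "char M t * E t = E 0"
    using c[of 0] c[of t] by (simp add: char_zero)
  then have "char M t = E 0 / E t"
    by (simp add: E_def field_simps)
  then show ?thesis
    by (simp add: E_def exp_diff right_diff_distrib)
qed

text \<open>By \<open>gamma_stein_char\<close> both characteristic functions equal one formula in
  \<open>r\<close> and \<open>\<alpha>\<close> alone.\<close>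

lemma gamma_stein_unique:
  assumes "real_distribution M" "integrable M (\<lambda>x. x)" "gamma_stein r \<alpha> M"
    and "real_distribution N" "integrable N (\<lambda>x. x)" "gamma_stein r \<alpha> N" and "0 < \<alpha>"
  shows "M = N"
  using assms by (intro Levy_uniqueness ext) (simp_all add: real_distribution.gamma_stein_char)

section \<open>Gamma densities: total mass, moments, Stein identity\<close>

lemma gamma_density_nonneg: "0 < r \<Longrightarrow> 0 \<le> gamma_density r \<alpha> x"
  by (simp add: gamma_density_def Gamma_real_pos less_imp_le)

lemma borel_measurable_gamma_density [measurable]: "gamma_density r \<alpha> \<in> borel_measurable borel"
  unfolding gamma_density_def by measurable

text \<open>Reduces the total mass to rate 1, where it is Euler's integral.\<close>

lemma gamma_density_scale: "0 < \<alpha> \<Longrightarrow> gamma_density r \<alpha> x = \<alpha> * gamma_density r 1 (\<alpha> * x)"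
  by (simp add: gamma_density_def zero_less_mult_iff powr_mult powr_diff)

text \<open>Since \<open>\<Gamma>(r + 1) = r \<Gamma>(r)\<close>, a factor \<open>x\<close> raises
  the shape by one. The first two moments thereby reduce to total masses of Gamma densities.\<close>

lemma times_gamma_density:
  assumes "0 < r" "0 < \<alpha>"
  shows "x * gamma_density r \<alpha> x = r / \<alpha> * gamma_density (r + 1) \<alpha> x"
proof -
  have "Gamma r \<noteq> 0"
    using Gamma_real_pos[OF assms(1)] by simp
  moreover have "Gamma (r + 1) = r * Gamma r"
    using assms by (intro Gamma_plus1) (auto simp: nonpos_Ints_def)
  ultimately show ?thesis
    using assms by (simp add: gamma_density_def powr_add powr_diff field_simps)
qed

lemma nn_integral_gamma_density:
  assumes "0 < r" "0 < \<alpha>"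
  shows "(\<integral>\<^sup>+x. gamma_density r \<alpha> x \<partial>lborel) = 1"
proof -
  have "(\<integral>\<^sup>+x. gamma_density r \<alpha> x \<partial>lborel) = ennreal \<alpha> * (\<integral>\<^sup>+x. gamma_density r 1 (0 + \<alpha> * x) \<partial>lborel)"
    using assms by (simp add: gamma_density_scale[of \<alpha>] ennreal_mult gamma_density_nonneg nn_integral_cmult)
  also have "\<dots> = (\<integral>\<^sup>+x. gamma_density r 1 x \<partial>lborel)"
    using assms by (subst nn_integral_real_affine[where c = \<alpha> and t = 0]) auto
  \<comment> \<open>The integrands agree at \<open>x = 0\<close> too, because
    \<open>0 powr (r - 1)\<close> is 0.\<close>
  also have "\<dots> = (\<integral>\<^sup>+x. ennreal (1 / Gamma r) * ennreal (indicator {0..} x * x powr (r - 1) / exp x) \<partial>lborel)"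
    using assms Gamma_real_pos[of r]
    by (intro nn_integral_cong)
      (auto simp: gamma_density_def exp_minus field_simps indicator_def simp flip: ennreal_mult)
  also have "\<dots> = ennreal (1 / Gamma r) * ennreal (Gamma r)"
    using assms by (subst nn_integral_cmult) (simp_all add: Gamma_conv_nn_integral_real)
  also have "\<dots> = 1"
    using Gamma_real_pos[OF assms(1)] by (simp flip: ennreal_mult)
  finally show ?thesis .
qed

lemma integrable_gamma_density:
  assumes "0 < r" "0 < \<alpha>"
  shows "integrable lborel (gamma_density r \<alpha>)"
  using assms by (intro integrableI_nonneg) (auto simp: gamma_density_nonneg nn_integral_gamma_density)

lemma integral_gamma_density:
  assumes "0 < r" "0 < \<alpha>"
  shows "(\<integral>x. gamma_density r \<alpha> x \<partial>lborel) = 1"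
  using assms by (simp add: integral_eq_nn_integral gamma_density_nonneg nn_integral_gamma_density)

lemma real_distribution_gamma:
  assumes "0 < r" "0 < \<alpha>"
  shows "real_distribution (density lborel (gamma_density r \<alpha>))"
proof -
  interpret prob_space "density lborel (gamma_density r \<alpha>)"
    using assms by (intro prob_spaceI) (simp add: emeasure_density nn_integral_gamma_density)
  show ?thesis
    by unfold_locales auto
qed

lemma gamma_first_moment:
  assumes "0 < r" "0 < \<alpha>"
  shows "integrable (density lborel (gamma_density r \<alpha>)) (\<lambda>x. x)"
    and "(\<integral>x. x \<partial>density lborel (gamma_density r \<alpha>)) = r / \<alpha>"
  using assms times_gamma_density[OF assms]
  by (simp_all add: integrable_real_density integral_real_density gamma_density_nonneg mult.commute
      integrable_gamma_density integral_gamma_density)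

lemma gamma_second_moment:
  assumes "0 < r" "0 < \<alpha>"
  shows "(\<integral>x. x\<^sup>2 \<partial>density lborel (gamma_density r \<alpha>)) = r * (r + 1) / \<alpha>\<^sup>2"
proof -
  have "gamma_density r \<alpha> x * x\<^sup>2 = r * (r + 1) / \<alpha>\<^sup>2 * gamma_density (r + 2) \<alpha> x" for x
    using times_gamma_density[of r \<alpha> x] times_gamma_density[of "r + 1" \<alpha> x] assms
    by (simp add: power2_eq_square mult_ac add.assoc)
  then show ?thesis
    using assms by (simp add: integral_real_density gamma_density_nonneg integral_gamma_density)
qed

text \<open>Integration by parts: \<open>x p(x)\<close> has derivative \<open>(r - \<alpha> x) p(x)\<close>, where \<open>p\<close> is the
  Gamma density, and it vanishes at both ends.\<close>

lemma gamma_stein_gamma: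
  assumes r: "0 < r" and \<alpha>: "0 < \<alpha>"
  shows "gamma_stein r \<alpha> (density lborel (gamma_density r \<alpha>))"
  unfolding gamma_stein_def
proof
  fix t
  let ?P = "density lborel (gamma_density r \<alpha>)"
  interpret real_distribution ?P
    using assms by (rule real_distribution_gamma)
  \<comment> \<open>\<open>q\<close> is the density formula without the cutoff at 0, and
    \<open>g x = x * q x\<close> for \<open>x > 0\<close>. The function \<open>h\<close> is chosen
    so that \<open>F\<close> has derivative \<open>q x *\<^sub>R h x\<close> there; the Stein
    identity says that \<open>h\<close> has mean 0.\<close>
  define C where "C = 1 / Gamma r * \<alpha> powr r"
  define q where "q x = C * x powr (r - 1) * exp (- \<alpha> * x)" for x
  define g where "g x = C * x powr r * exp (- \<alpha> * x)" for x
  define F where "F x = of_real (g x) * iexp (t * x)" for x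
  define h where "h x = (of_real r - of_real \<alpha> * of_real x + \<i> * of_real t * of_real x) * iexp (t * x)" for x
  have h_int: "integrable ?P h"
  proof -
    have "h = (\<lambda>x. of_real r * iexp (t * x) + (\<i> * of_real t - of_real \<alpha>) * (of_real x * iexp (t * x)))"
      by (auto simp: h_def algebra_simps)
    then show ?thesis
      using integrable_times_iexp[OF gamma_first_moment(1)[OF assms], of t]
        integrable_iexp[of "\<lambda>x. of_real (t * x)"] by simp
  qed
  have h_meas [measurable]: "h \<in> borel_measurable borel"
    unfolding h_def by measurable
  have dens: "gamma_density r \<alpha> x *\<^sub>R h x = indicator {0<..} x *\<^sub>R (q x *\<^sub>R h x)" for x
    by (simp add: gamma_density_def q_def C_def indicator_def)
  have "integrable lborel (\<lambda>x. gamma_density r \<alpha> x *\<^sub>R h x)"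
    using h_int r by (subst (asm) integrable_density) (auto simp: gamma_density_nonneg)
  then have qh_int: "set_integrable lborel {0<..} (\<lambda>x. q x *\<^sub>R h x)"
    unfolding set_integrable_def dens .
  \<comment> \<open>The value \<open>0 - 0\<close> is the limit of \<open>F\<close> at infinity
    minus its limit at 0.\<close>
  have "(LBINT x=ereal 0..\<infinity>. q x *\<^sub>R h x) = 0 - 0"
  proof (rule interval_integral_FTC_integrable[where F = F])
    fix x :: real assume "ereal 0 < ereal x"
    then have x: "0 < x" by simp
    have "(g has_real_derivative (r - \<alpha> * x) * q x) (at x)"
      unfolding g_def q_def using x
      by (auto intro!: derivative_eq_intros simp: field_simps powr_diff)
    then have "((\<lambda>x. complex_of_real (g x)) has_vector_derivative of_real ((r - \<alpha> * x) * q x)) (at x)"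
      by (rule has_vector_derivative_of_real)
    moreover have "((\<lambda>x. iexp (t * x)) has_vector_derivative \<i> * of_real t * iexp (t * x)) (at x)"
      by (auto intro!: derivative_eq_intros simp: has_vector_derivative_complex_iff Re_exp Im_exp)
    ultimately have "(F has_vector_derivative of_real (g x) * (\<i> * of_real t * iexp (t * x)) +
        of_real ((r - \<alpha> * x) * q x) * iexp (t * x)) (at x)"
      unfolding F_def by (rule has_vector_derivative_mult)
    moreover have "g x = x * q x"
      using x by (simp add: g_def q_def powr_diff)
    ultimately show "(F has_vector_derivative q x *\<^sub>R h x) (at x)"
      by (simp add: h_def scaleR_conv_of_real algebra_simps)
    show "isCont (\<lambda>x. q x *\<^sub>R h x) x"
      unfolding q_def h_def using x by (intro continuous_intros) auto
  next
    \<comment> \<open>At 0 the factor \<open>x powr r\<close> tends to 0 because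
      \<open>r > 0\<close>; at infinity the exponential dominates because
      \<open>\<alpha> > 0\<close>.\<close>
    have "(g \<longlongrightarrow> 0) (at_right 0)" "(g \<longlongrightarrow> 0) at_top"
      unfolding g_def using r \<alpha> by real_asymp+
    moreover have "norm (F x) = \<bar>g x\<bar>" for x
      by (simp add: F_def norm_mult)
    ultimately show "((F \<circ> real_of_ereal) \<longlongrightarrow> 0) (at_right (ereal 0))"
      "((F \<circ> real_of_ereal) \<longlongrightarrow> 0) (at_left \<infinity>)"
      unfolding ereal_tendsto_simps
      by (simp_all flip: tendsto_norm_zero_iff[of F] add: tendsto_rabs_zero)
  qed (use qh_int in auto)
  then have "(LINT x:{0<..}|lborel. q x *\<^sub>R h x) = 0"
    by (simp add: interval_integral_to_infinity_eq)
  then have "(\<integral>x. h x \<partial>?P) = 0"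
    using r by (subst integral_density) (auto simp: gamma_density_nonneg dens set_lebesgue_integral_def)
  moreover have "(\<integral>x. h x \<partial>?P) = \<i> * of_real t * (\<integral>x. of_real x * iexp (t * x) \<partial>?P) -
      (\<integral>x. of_real (\<alpha> * x - r) * iexp (t * x) \<partial>?P)"
  proof -
    have *: "integrable ?P (\<lambda>x. \<i> * of_real t * (of_real x * iexp (t * x)))"
      using integrable_times_iexp[OF gamma_first_moment(1)[OF assms], of t] by simp
    have eq: "of_real (\<alpha> * x - r) * iexp (t * x) = \<i> * of_real t * (of_real x * iexp (t * x)) - h x" for x
      by (simp add: h_def algebra_simps)
    show ?thesis
      unfolding eq by (subst Bochner_Integration.integral_diff[OF * h_int]) simp
  qed
  ultimately show "(\<integral>x. of_real (\<alpha> * x - r) * iexp (t * x) \<partial>?P) =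
      \<i> * of_real t * (\<integral>x. of_real x * iexp (t * x) \<partial>?P)"
    by simp
qed

section \<open>Characteristic functions of the biased distributions\<close>

text \<open>The test functions of both biased distributions are real, so complex exponentials enter
  through their real and imaginary parts.\<close>

lemma integral_times_iexp:
  fixes g X :: "'a \<Rightarrow> real"
  assumes "integrable M g" and [measurable]: "X \<in> borel_measurable M"
  shows "(\<integral>x. of_real (g x) * iexp (t * X x) \<partial>M) =
    Complex (\<integral>x. g x * cos (t * X x) \<partial>M) (\<integral>x. g x * sin (t * X x) \<partial>M)"
proof -
  have [measurable]: "g \<in> borel_measurable M"
    using assms by auto
  have "integrable M (\<lambda>x. of_real (g x) * iexp (t * X x))"
    by (rule Bochner_Integration.integrable_bound[OF integrable_norm[OF assms(1)]]) (auto simp: norm_mult)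
  from integral_Re[OF this] integral_Im[OF this] show ?thesis
    by (simp add: complex_eq_iff Re_exp Im_exp)
qed

lemma integrable_times_bounded:
  fixes g h :: "'a \<Rightarrow> real"
  assumes "integrable M g" "h \<in> borel_measurable M" "\<And>x. \<bar>h x\<bar> \<le> B"
  shows "integrable M (\<lambda>x. g x * h x)"
proof (rule Bochner_Integration.integrable_bound[OF integrable_mult_right[OF integrable_norm[OF assms(1)], of B]])
  show "AE x in M. norm (g x * h x) \<le> norm (B * norm (g x))"
  proof (rule AE_I2)
    fix x
    have "\<bar>g x\<bar> * \<bar>h x\<bar> \<le> \<bar>g x\<bar> * \<bar>B\<bar>"
      using assms(3)[of x] by (intro mult_left_mono) auto
    then show "norm (g x * h x) \<le> norm (B * norm (g x))"
      by (simp add: abs_mult mult.commute)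
  qed
qed (use assms in auto)

text \<open>Cosine and sine are bounded, so the finite mean of \<open>V\<close> makes both
  admissible test functions.\<close>

lemma size_biased_char:
  assumes "size_biased M V N Vs"
  shows "(\<integral>x. of_real (V x) * iexp (t * V x) \<partial>M) = of_real (\<integral>x. V x \<partial>M) * char (distr N borel Vs) t"
proof -
  have V: "V \<in> borel_measurable M" "integrable M V" and Vs [measurable]: "Vs \<in> borel_measurable N"
    and N: "prob_space N"
    and *: "\<And>f :: real \<Rightarrow> real. f \<in> borel_measurable borel \<Longrightarrow> integrable M (\<lambda>x. V x * f (V x)) \<Longrightarrow>
        (\<integral>x. V x * f (V x) \<partial>M) = (\<integral>x. V x \<partial>M) * (\<integral>y. f (Vs y) \<partial>N)"
    using assms unfolding size_biased_def by auto
  interpret N: prob_space N by (rule N)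
  have "(\<integral>x. V x * cos (t * V x) \<partial>M) = (\<integral>x. V x \<partial>M) * (\<integral>y. cos (t * Vs y) \<partial>N)"
    using V by (intro *[of "\<lambda>v. cos (t * v)"] integrable_times_bounded[where B = 1]) auto
  moreover have "(\<integral>x. V x * sin (t * V x) \<partial>M) = (\<integral>x. V x \<partial>M) * (\<integral>y. sin (t * Vs y) \<partial>N)"
    using V by (intro *[of "\<lambda>v. sin (t * v)"] integrable_times_bounded[where B = 1]) auto
  moreover have "char (distr N borel Vs) t = Complex (\<integral>y. cos (t * Vs y) \<partial>N) (\<integral>y. sin (t * Vs y) \<partial>N)"
    using integral_times_iexp[of N "\<lambda>_. 1" Vs t] by (simp add: char_def integral_distr)
  ultimately show ?thesis
    by (subst integral_times_iexp[OF V(2,1)]) (simp add: complex_eq_iff)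
qed

text \<open>The derivatives \<open>- t * sin (t * w)\<close> and \<open>t * cos (t * w)\<close> of
  the two test functions combine to \<open>\<i> t\<close> times the exponential. Boundedness of the
  functions and of their derivatives gives both integrability conditions.\<close>

lemma zero_biased_char:
  assumes "zero_biased M W K Wz"
  defines "\<mu> \<equiv> \<integral>x. W x \<partial>M"
  shows "(\<integral>x. of_real (W x - \<mu>) * iexp (t * W x) \<partial>M) =
    \<i> * of_real t * of_real (prob_space.variance M W) * char (distr K borel Wz) t"
proof -
  let ?v = "prob_space.variance M W"
  have W: "W \<in> borel_measurable M" "integrable M W" and Wz [measurable]: "Wz \<in> borel_measurable K"
    and M: "prob_space M" and K: "prob_space K"
    and *: "\<And>f f' :: real \<Rightarrow> real. (\<And>s. (f has_real_derivative f' s) (at s)) \<Longrightarrow>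
        integrable M (\<lambda>x. W x * f (W x)) \<Longrightarrow> integrable K (\<lambda>y. f' (Wz y)) \<Longrightarrow>
        (\<integral>x. (W x - \<mu>) * f (W x) \<partial>M) = ?v * (\<integral>y. f' (Wz y) \<partial>K)"
    using assms unfolding zero_biased_def \<mu>_def by auto
  interpret M: prob_space M by (rule M)
  interpret K: prob_space K by (rule K)
  have bdd: "integrable K (\<lambda>y. c * h (t * Wz y))"
    if "h \<in> borel_measurable borel" "\<And>x. \<bar>h x\<bar> \<le> 1" for h :: "real \<Rightarrow> real" and c
    using that by (intro integrable_times_bounded[where B = 1]) auto
  have "(\<integral>x. (W x - \<mu>) * cos (t * W x) \<partial>M) = ?v * (\<integral>y. - t * sin (t * Wz y) \<partial>K)"
    using W by (intro *[of "\<lambda>w. cos (t * w)" "\<lambda>w. - t * sin (t * w)"] bdd integrable_times_bounded[where B = 1])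
      (auto intro!: derivative_eq_intros)
  moreover have "(\<integral>x. (W x - \<mu>) * sin (t * W x) \<partial>M) = ?v * (\<integral>y. t * cos (t * Wz y) \<partial>K)"
    using W by (intro *[of "\<lambda>w. sin (t * w)" "\<lambda>w. t * cos (t * w)"] bdd integrable_times_bounded[where B = 1])
      (auto intro!: derivative_eq_intros)
  moreover have "char (distr K borel Wz) t = Complex (\<integral>y. cos (t * Wz y) \<partial>K) (\<integral>y. sin (t * Wz y) \<partial>K)"
    using integral_times_iexp[of K "\<lambda>_. 1" Wz t] by (simp add: char_def integral_distr)
  ultimately show ?thesis
    using W by (subst integral_times_iexp) (auto simp: complex_eq_iff)
qed

section \<open>Equality of the biased laws as a Stein identity\<close>

theorem theorem2p1:
  fixes M :: "'a measure" and N :: "'b measure" and K :: "'c measure"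
    and W :: "'a \<Rightarrow> real" and Ws :: "'b \<Rightarrow> real" and Wz :: "'c \<Rightarrow> real" and \<mu> \<sigma> :: real
  assumes "prob_space M" and "W \<in> borel_measurable M" and "AE x in M. 0 \<le> W x"
    and "integrable M W" and "prob_space.expectation M W = \<mu>"
    and "integrable M (\<lambda>x. (W x)\<^sup>2)" and "prob_space.variance M W = \<sigma>\<^sup>2" and "0 < \<sigma>\<^sup>2"
    and "size_biased M W N Ws"
    and "zero_biased M W K Wz"
  shows "(\<exists>r \<alpha>. 0 < r \<and> 0 < \<alpha> \<and> distributed M lborel W (gamma_density r \<alpha>)) \<longleftrightarrow>
         distr N borel Ws = distr K borel Wz"
proof -
  interpret M: prob_space M by fact
  interpret N: prob_space N using assms(9) by (simp add: size_biased_def)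
  interpret K: prob_space K using assms(10) by (simp add: zero_biased_def)
  note [measurable] = assms(2)
  have [measurable]: "Ws \<in> borel_measurable N" "Wz \<in> borel_measurable K"
    using assms(9,10) by (simp_all add: size_biased_def zero_biased_def)
  have \<mu>: "0 < \<mu>"
    using assms(5,9) by (simp add: size_biased_def)
  note \<sigma> = assms(8)
  define Q where "Q = distr M borel W"
  interpret Q: real_distribution Q
    unfolding Q_def by simp
  interpret S: real_distribution "distr N borel Ws" by simp
  interpret Z: real_distribution "distr K borel Wz" by simp
  have Q_int: "integrable Q (\<lambda>x. x)"
    using assms(4) by (simp add: Q_def integrable_distr_eq)
  \<comment> \<open>These values solve \<open>r / \<alpha> = \<mu>\<close> and
    \<open>r / \<alpha>^2 = \<sigma>^2\<close>, the mean and variance equations of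
    \<open>\<Gamma>(r, \<alpha>)\<close>.\<close>
  define r \<alpha> where "r = \<mu>\<^sup>2 / \<sigma>\<^sup>2" and "\<alpha> = \<mu> / \<sigma>\<^sup>2"
  have r: "0 < r" and \<alpha>: "0 < \<alpha>"
    using \<mu> \<sigma> by (simp_all add: r_def \<alpha>_def)
  \<comment> \<open>With \<open>S\<close> and \<open>Z\<close>, the identity
    \<open>gamma_stein r \<alpha> Q\<close> says that \<open>\<i> t \<mu>\<close> times the
    characteristic function of \<open>Wz\<close> equals \<open>\<i> t \<mu>\<close> times that of
    \<open>Ws\<close>.\<close>
  have S: "(\<integral>x. of_real x * iexp (t * x) \<partial>Q) = of_real \<mu> * char (distr N borel Ws) t" for t
    using size_biased_char[OF assms(9), of t] assms(5) by (simp add: Q_def integral_distr)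
  have Z: "(\<integral>x. of_real (\<alpha> * x - r) * iexp (t * x) \<partial>Q) = \<i> * of_real t * (of_real \<mu> * char (distr K borel Wz) t)" for t
  proof -
    \<comment> \<open>Since \<open>r = \<alpha> * \<mu>\<close>, the Stein factor is a multiple of
      the centred variable that zero biasing uses.\<close>
    have "of_real (\<alpha> * x - r) = complex_of_real \<alpha> * of_real (x - \<mu>)" for x
      by (simp add: \<alpha>_def r_def power2_eq_square right_diff_distrib)
    then have "(\<integral>x. of_real (\<alpha> * x - r) * iexp (t * x) \<partial>Q) =
        of_real \<alpha> * (\<integral>x. of_real (W x - \<mu>) * iexp (t * W x) \<partial>M)"
      by (simp add: Q_def integral_distr mult.assoc del: of_real_diff)
    also have "\<dots> = of_real \<alpha> * (\<i> * of_real t * of_real (\<sigma>\<^sup>2) * char (distr K borel Wz) t)"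
      using zero_biased_char[OF assms(10), of t] assms(5,7) by simp
    also have "\<dots> = \<i> * of_real t * (of_real (\<alpha> * \<sigma>\<^sup>2) * char (distr K borel Wz) t)"
      by simp
    also have "\<alpha> * \<sigma>\<^sup>2 = \<mu>"
      using \<sigma> by (simp add: \<alpha>_def)
    finally show ?thesis .
  qed
  have "distr N borel Ws = distr K borel Wz \<longleftrightarrow> gamma_stein r \<alpha> Q"
  proof
    assume "distr N borel Ws = distr K borel Wz"
    then show "gamma_stein r \<alpha> Q"
      unfolding gamma_stein_def S Z by simp
  next
    assume stein: "gamma_stein r \<alpha> Q"
    have "char (distr N borel Ws) t = char (distr K borel Wz) t" for t
    \<comment> \<open>At \<open>t = 0\<close> the identity only says \<open>0 = 0\<close>, but both
      characteristic functions are 1 there. Elsewhere \<open>\<i> t \<mu>\<close> cancels.\<close>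
    proof (cases "t = 0")
      case True
      then show ?thesis
        by (simp only: S.char_zero Z.char_zero)
    next
      case False
      then show ?thesis
        using stein[unfolded gamma_stein_def S Z, rule_format, of t] \<mu> by simp
    qed
    then show "distr N borel Ws = distr K borel Wz"
      by (intro Levy_uniqueness S.real_distribution_axioms Z.real_distribution_axioms ext)
  qed
  moreover have "gamma_stein r \<alpha> Q \<longleftrightarrow>
      (\<exists>r \<alpha>. 0 < r \<and> 0 < \<alpha> \<and> distributed M lborel W (gamma_density r \<alpha>))"
  proof
    assume "gamma_stein r \<alpha> Q"
    then have "Q = density lborel (gamma_density r \<alpha>)"
      using r \<alpha> Q.real_distribution_axioms Q_int
      by (intro gamma_stein_unique[of _ r \<alpha>] real_distribution_gamma gamma_first_moment gamma_stein_gamma)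
    \<comment> \<open>\<open>distributed\<close> pushes forward to \<open>lborel\<close>, while
      \<open>Q\<close> is taken on \<open>borel\<close>; the measurable sets are the same.\<close>
    moreover have "distr M lborel W = Q"
      unfolding Q_def by (rule distr_cong) auto
    ultimately have "distributed M lborel W (gamma_density r \<alpha>)"
      by (simp add: distributed_def)
    then show "\<exists>r \<alpha>. 0 < r \<and> 0 < \<alpha> \<and> distributed M lborel W (gamma_density r \<alpha>)"
      using r \<alpha> by blast
  next
    assume "\<exists>r \<alpha>. 0 < r \<and> 0 < \<alpha> \<and> distributed M lborel W (gamma_density r \<alpha>)"
    then obtain a b where a: "0 < a" and b: "0 < b" and dist: "distributed M lborel W (gamma_density a b)"
      by blast
    have "Q = distr M lborel W"
      unfolding Q_def by (rule distr_cong) auto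
    with dist have Q: "Q = density lborel (gamma_density a b)"
      by (simp add: distributed_def)
    \<comment> \<open>The given parameters \<open>a\<close> and \<open>b\<close> are arbitrary;
      matching mean and variance identifies them with \<open>r\<close> and
      \<open>\<alpha>\<close>.\<close>
    have \<mu>_eq: "\<mu> = a / b"
    proof -
      have "\<mu> = (\<integral>x. x \<partial>Q)"
        using assms(5) by (simp add: Q_def integral_distr)
      then show ?thesis
        using gamma_first_moment(2)[OF a b] Q by simp
    qed
    have "\<sigma>\<^sup>2 = M.expectation (\<lambda>x. (W x)\<^sup>2) - \<mu>\<^sup>2"
      using M.variance_eq[OF assms(4,6)] assms(5,7) by simp
    also have "M.expectation (\<lambda>x. (W x)\<^sup>2) = (\<integral>x. x\<^sup>2 \<partial>Q)"
      by (simp add: Q_def integral_distr)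
    also have "\<dots> = a * (a + 1) / b\<^sup>2"
      using gamma_second_moment[OF a b] Q by simp
    finally have \<sigma>_eq: "\<sigma>\<^sup>2 = a / b\<^sup>2"
      using b by (simp add: \<mu>_eq field_simps power2_eq_square)
    have "r = a" "\<alpha> = b"
      unfolding r_def \<alpha>_def \<mu>_eq \<sigma>_eq using a b by (simp_all add: field_simps power2_eq_square)
    then show "gamma_stein r \<alpha> Q"
      using gamma_stein_gamma[OF a b] Q by simp
  qed
  ultimately show ?thesis
    by blast
qed

end
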